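(* Fix an integer $r\geq 3$, and let $c_{r,2}=4^r-3^r+2^r$ and $d_{r,2}=3^r+1$. Then: (i) The order of $f_{r,2}(x):=1+x+x^{2^r}+x^{2^r+2}\in\mathbb{F}_2[x]$ divides $4^r+2^r+1$. (ii) The polynomial $h_{r,2}(x):=(1+x^{4^r+2^r+1})/f_{r,2}(x)\in\mathbb{F}_2[x]$ satisfies $\ell_1(h_{r,2}(x))=c_{r,2}$. (iii) Hence $\beta_{4^r+2^r+1}(f_{r,2}(x))=(c_{r,2},d_{r,2})$, and $f_{r,2}(x)$ is robust.
   Context: For $f\in\mathbb{F}_2[x]$ with $f(0)=1$ and $\deg f\ge 1$, the order $\operatorname{ord}(f)$ is the least integer $D\ge 1$ such that $f(x)\mid 1+x^D$ in $\mathbb{F}_2[x]$. For $g\in\mathbb{F}_2[x]$, $\ell_1(g)$ is the number of monomials of $g$ (terms with coefficient $1$), and for $N\ge\deg g$, $\ell_{0,N}(g)$ is the number of exponents $k\in\{0,1,\dots,N\}$ for which the coefficient of $x^k$ in $g$ is $0$. If $N$ is a positive multiple of $\operatorname{ord}(f)$ and $g(x)=(1+x^N)/f(x)$, then $\beta_N(f)=(\ell_1(g),\ell_{0,N-1}(g))$. With $D=\operatorname{ord}(f)$ and $f^*(x)=(1+x^D)/f(x)$, the polynomial $f$ is called robust if $\ell_1(f^* )>\ell_{0,D-1}(f^* )+1$, equivalently $\ell_1(f^* )>(D+1)/2$. *)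

theory Defs
  imports "HOL-Computational_Algebra.Polynomial" "HOL-Library.Z2"
begin

text \<open>
  The type \<^typ>\<open>bit\<close> is the field with two elements, so \<open>bit poly\<close> is the ring of polynomials
  over it, and \<open>monom 1 n\<close> is the \<open>n\<close>-th power of the variable. The operation \<open>div\<close> is Euclidean
  division of polynomials; it is the exact quotient whenever the divisor divides the dividend.
\<close>

text \<open>
  Meaningful for polynomials with constant term 1 (and degree at least 1); for those the least
  element exists, by \<open>poly_ord_exists\<close> below.
\<close>

definition poly_ord :: "bit poly \<Rightarrow> nat" where
  "poly_ord f = (LEAST D. D \<ge> 1 \<and> f dvd 1 + monom 1 D)"

definition ell1 :: "bit poly \<Rightarrow> nat" where
  "ell1 g = card {k. coeff g k = 1}"

definition ell0 :: "nat \<Rightarrow> bit poly \<Rightarrow> nat" where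
  "ell0 N g = card {k \<in> {0..N}. coeff g k = 0}"

text \<open>Meaningful when \<open>N\<close> is a positive multiple of \<open>poly_ord f\<close>.\<close>

definition beta :: "nat \<Rightarrow> bit poly \<Rightarrow> nat \<times> nat" where
  "beta N f = (let g = (1 + monom 1 N) div f in (ell1 g, ell0 (N - 1) g))"

definition poly_star :: "bit poly \<Rightarrow> bit poly" where
  "poly_star f = (1 + monom 1 (poly_ord f)) div f"

text \<open>The first two conjuncts are the standing conditions under which the order is defined.\<close>

definition robust :: "bit poly \<Rightarrow> bool" where
  "robust f \<longleftrightarrow> coeff f 0 = 1 \<and> degree f \<ge> 1 \<and>
     ell1 (poly_star f) > ell0 (poly_ord f - 1) (poly_star f) + 1"

definition f_r2 :: "nat \<Rightarrow> bit poly" where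
  "f_r2 r = 1 + monom 1 1 + monom 1 (2 ^ r) + monom 1 (2 ^ r + 2)"

definition h_r2 :: "nat \<Rightarrow> bit poly" where
  "h_r2 r = (1 + monom 1 (4 ^ r + 2 ^ r + 1)) div f_r2 r"

text \<open>The subtraction on natural numbers does not truncate, as \<open>3 ^ r \<le> 4 ^ r\<close>.\<close>

definition c_r2 :: "nat \<Rightarrow> nat" where
  "c_r2 r = 4 ^ r - 3 ^ r + 2 ^ r"

definition d_r2 :: "nat \<Rightarrow> nat" where
  "d_r2 r = 3 ^ r + 1"

lemma dvd_monom_mult_cancel:
  fixes f u :: "bit poly"
  assumes f0: "coeff f 0 = 1" and "f dvd monom 1 i * u"
  shows "f dvd u"
  using assms(2)
proof (induction i arbitrary: u)
  case 0
  then show ?case by (simp flip: one_pCons add: monom_0)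
next
  case (Suc i)
  have "f dvd pCons 0 (monom 1 i * u)"
    using Suc.prems by (simp add: monom_Suc)
  then obtain q where q: "pCons 0 (monom 1 i * u) = f * q" by (elim dvdE)
  have "coeff (f * q) 0 = 0" by (simp flip: q)
  then have "coeff q 0 = 0" using f0 by (simp only: coeff_mult_0 mult_1_left)
  then obtain q' where "q = pCons 0 q'" by (metis pCons_cases coeff_pCons_0)
  with q have "monom 1 i * u = f * q'" by simp
  then have "f dvd monom 1 i * u" by simp
  then show ?case by (rule Suc.IH)
qed

lemma finite_bit_poly_degree_le: "finite {p :: bit poly. degree p \<le> n}"
proof (rule finite_imageD)
  have "(UNIV :: bit set) \<subseteq> {0, 1}" using bit_not_zero_iff by blast
  then have "finite (UNIV :: bit set)" by (rule finite_subset) simp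
  then have "finite {xs :: bit list. set xs \<subseteq> UNIV \<and> length xs = Suc n}"
    by (rule finite_lists_length_eq)
  then show "finite ((\<lambda>p. map (coeff p) [0..<Suc n]) ` {p :: bit poly. degree p \<le> n})"
    by (rule rev_finite_subset) auto
  show "inj_on (\<lambda>p. map (coeff p) [0..<Suc n]) {p :: bit poly. degree p \<le> n}"
  proof (rule inj_onI)
    fix p q :: "bit poly"
    assume deg: "p \<in> {p. degree p \<le> n}" "q \<in> {p. degree p \<le> n}"
      and eq: "map (coeff p) [0..<Suc n] = map (coeff q) [0..<Suc n]"
    show "p = q"
    proof (rule poly_eqI)
      fix k
      show "coeff p k = coeff q k"
      proof (cases "k \<le> n")
        case True
        then have "k \<in> set [0..<Suc n]" by auto
        with eq show ?thesis by (meson map_eq_conv)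
      next
        case False
        with deg show ?thesis by (simp add: coeff_eq_0)
      qed
    qed
  qed
qed

lemma poly_ord_exists:
  fixes f :: "bit poly"
  assumes f0: "coeff f 0 = 1"
  shows "\<exists>D\<ge>1. f dvd 1 + monom 1 D"
proof -
  have "f \<noteq> 0" using f0 by auto
  let ?g = "\<lambda>k. monom 1 k mod f"
  have "range ?g \<subseteq> {p. degree p \<le> degree f}"
    using degree_mod_less[OF \<open>f \<noteq> 0\<close>] by (auto intro: less_imp_le) (metis degree_0 le0 less_imp_le)
  then have "finite (range ?g)"
    by (rule finite_subset) (rule finite_bit_poly_degree_le)
  then have "\<not> inj ?g" using finite_imageD infinite_UNIV_nat by blast
  then obtain i j where ij: "?g i = ?g j" "i < j"
    by (metis (mono_tags, lifting) injI linorder_neqE_nat)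
  then have "f dvd monom 1 j - monom 1 i" by (metis mod_eq_dvd_iff)
  also have "monom 1 j - monom 1 i = monom 1 i * (1 + monom (1 :: bit) (j - i))"
  proof (rule poly_eqI)
    fix n
    have "monom (1 :: bit) j = monom 1 i * monom 1 (j - i)"
      using ij(2) by (simp add: mult_monom)
    then have "monom 1 i * (1 + monom (1 :: bit) (j - i)) = monom 1 i + monom 1 j"
      by (simp add: distrib_left)
    then show "coeff (monom 1 j - monom 1 i) n
        = coeff (monom 1 i * (1 + monom (1 :: bit) (j - i))) n" by (simp add: add.commute)
  qed
  finally have "f dvd 1 + monom 1 (j - i)" by (rule dvd_monom_mult_cancel[OF f0])
  with ij(2) show ?thesis by (intro exI[of _ "j - i"]) simp
qed

end

(* With q = 2^r the polynomial factors as f = (1 + x)(1 + u), where u = x^q (1 + x). In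
   characteristic 2 the geometric sum of the powers u^k over k < q times 1 + u is
   1 + u^q = 1 + x^(q^2) + x^(q^2 + q); adding x^(q^2) (1 + u) turns this into 1 + x^(q^2 + q + 1).
   Dividing by 1 + x as well gives h as a concatenation of q blocks of length q: the block k = 0
   consists of ones, and the block k > 0 is the bitwise complement of row k - 1 of Pascal's triangle
   modulo 2. The first q rows of that triangle have 3^r odd entries and the last of them has 2^r,
   which yields the weight of h. If D is the order of f and m D = q^2 + q + 1, then h consists of m
   copies of f^*, and m < q by comparing D with the degree of f; hence the surplus of ones in h
   is large enough to force robustness. *)

theory Submission
  imports Defs
begin

section \<open>Polynomials over the field with two elements\<close>

definition bitX :: "bit poly" where
  "bitX = monom 1 1"

lemma bitX_power: "bitX ^ n = monom 1 n"
  by (simp add: bitX_def monom_power)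

lemma bit_poly_two [simp]: "(2 :: bit poly) = 0"
  by (simp add: numeral_poly)

lemma bit_poly_add_self [simp]: "p + p = (0 :: bit poly)"
  by (simp flip: mult_2)

lemma bit_poly_minus: "p - q = p + (q :: bit poly)"
  by (rule poly_eqI) simp

lemma bit_poly_add_cancel [simp]: "p + (p + q) = (q :: bit poly)"
  by (simp flip: add.assoc)

lemma bit_poly_geometric_sum: "(1 + u) * (\<Sum>k<n. u ^ k) = 1 + (u :: bit poly) ^ n"
  using one_diff_power_eq[of u n] by (simp add: bit_poly_minus)

lemma bit_poly_freshman: "(1 + u) ^ (2 ^ r) = 1 + (u :: bit poly) ^ (2 ^ r)"
proof (induction r)
  case (Suc r)
  have "(1 + u) ^ (2 ^ Suc r) = ((1 + u) ^ (2 ^ r)) ^ 2"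
    by (simp add: mult.commute flip: power_mult)
  also have "\<dots> = 1 + (u ^ (2 ^ r)) ^ 2"
    by (simp add: Suc.IH power2_eq_square algebra_simps)
  finally show ?case
    by (simp add: mult.commute flip: power_mult)
qed simp

section \<open>Weights\<close>

lemma finite_coeff_eq_1: "finite {k. coeff g k = (1 :: bit)}"
  by (rule finite_subset[of _ "{..degree g}"]) (auto intro: le_degree)

lemma ell1_add_ell0:
  assumes "degree g \<le> N"
  shows "ell1 g + ell0 N g = Suc N"
proof -
  have "k \<le> N" if "coeff g k = 1" for k
    using that assms le_degree[of g k] by simp
  then have "{k. coeff g k = 1} \<union> {k \<in> {0..N}. coeff g k = 0} = {0..N}"
    by auto
  moreover have "card ({k. coeff g k = 1} \<union> {k \<in> {0..N}. coeff g k = 0}) = ell1 g + ell0 N g"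
    unfolding ell1_def ell0_def by (rule card_Un_disjoint) (auto simp: finite_coeff_eq_1)
  ultimately show ?thesis by simp
qed

text \<open>The supports are disjoint: \<open>p\<close> lives below exponent \<open>m\<close>, the
  shifted \<open>g\<close> at or above it.\<close>

lemma ell1_add_monom_mult:
  fixes p g :: "bit poly"
  assumes "\<And>k. k \<ge> m \<Longrightarrow> coeff p k = 0"
  shows "ell1 (p + monom 1 m * g) = ell1 p + ell1 g"
proof -
  have eq: "{k. coeff (p + monom 1 m * g) k = 1}
      = {k. coeff p k = 1} \<union> (\<lambda>k. m + k) ` {k. coeff g k = 1}" (is "_ = ?A \<union> ?B")
  proof (intro set_eqI)
    fix k
    show "k \<in> {k. coeff (p + monom 1 m * g) k = 1} \<longleftrightarrow> k \<in> ?A \<union> ?B"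
    proof (cases "k < m")
      case False
      then have "k = m + (k - m)" by simp
      with False assms[of k] show ?thesis
        by (auto simp: coeff_monom_mult intro: image_eqI)
    qed (auto simp: coeff_monom_mult)
  qed
  have "?A \<inter> ?B = {}"
    using assms by fastforce
  then have "card (?A \<union> ?B) = card ?A + card ?B"
    by (intro card_Un_disjoint finite_imageI finite_coeff_eq_1)
  also have "card ?B = ell1 g"
    unfolding ell1_def by (rule card_image) auto
  finally show ?thesis
    by (simp only: ell1_def eq)
qed

lemma ell1_sum_blocks:
  fixes P :: "nat \<Rightarrow> bit poly"
  assumes "\<And>k i. k < n \<Longrightarrow> i \<ge> q \<Longrightarrow> coeff (P k) i = 0"
  shows "ell1 (\<Sum>k<n. monom 1 (q * k) * P k) = (\<Sum>k<n. ell1 (P k))"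
  using assms
proof (induction n)
  case 0
  then show ?case by (simp add: ell1_def)
next
  case (Suc n)
  have "coeff (\<Sum>k<n. monom 1 (q * k) * P k) i = 0" if "i \<ge> q * n" for i
  proof -
    have "coeff (monom 1 (q * k) * P k) i = 0" if "k < n" for k
    proof -
      \<comment> \<open>Block \<open>k\<close> ends before exponent \<open>q * Suc k\<close>, hence
        before the block to be appended.\<close>
      have "q * Suc k \<le> q * n" using that by (intro mult_le_mono) auto
      with \<open>i \<ge> q * n\<close> have "i - q * k \<ge> q" by simp
      with Suc.prems[of k] \<open>k < n\<close> show ?thesis by (simp add: coeff_monom_mult)
    qed
    then show ?thesis by (simp add: coeff_sum)
  qed
  then show ?case
    using Suc by (simp add: ell1_add_monom_mult)
qed

lemma coeff_sum_powers:
  "coeff (\<Sum>i<n. bitX ^ i) k = (if k < n then 1 else (0 :: bit))"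
  by (simp add: coeff_sum bitX_power)

lemma ell1_sum_powers: "ell1 (\<Sum>i<n. bitX ^ i) = n"
proof -
  have "{k. coeff (\<Sum>i<n. bitX ^ i) k = (1 :: bit)} = {..<n}"
    unfolding coeff_sum_powers by auto
  then show ?thesis by (simp add: ell1_def)
qed

text \<open>Adding the all-ones polynomial flips every coefficient below \<open>n\<close>, so the
  two supports partition \<open>{..<n}\<close>.\<close>

lemma ell1_complement:
  assumes "\<And>k. k \<ge> n \<Longrightarrow> coeff p k = 0"
  shows "ell1 ((\<Sum>i<n. bitX ^ i) + p) + ell1 p = n"
proof -
  let ?q = "(\<Sum>i<n. bitX ^ i) + p"
  have q: "coeff ?q k = 1 \<longleftrightarrow> k < n \<and> coeff p k = 0" for k
    using assms[of k] by (auto simp: coeff_sum_powers)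
  have p: "coeff p k = 1 \<Longrightarrow> k < n" for k
    using assms[of k] by (cases "k < n") auto
  have "{k. coeff ?q k = 1} \<union> {k. coeff p k = 1} = {..<n}"
    unfolding q using p by auto
  moreover have "card ({k. coeff ?q k = 1} \<union> {k. coeff p k = 1}) = ell1 ?q + ell1 p"
    unfolding ell1_def q by (intro card_Un_disjoint finite_coeff_eq_1) auto
  ultimately show ?thesis by simp
qed

section \<open>Pascal's triangle modulo 2\<close>

lemma coeff_one_plus_x_power_eq_0:
  assumes "k < i"
  shows "coeff ((1 + bitX) ^ k) i = (0 :: bit)"
proof -
  have "degree (1 + bitX) \<le> 1"
    unfolding bitX_def by (intro degree_add_le) (simp_all add: degree_monom_le)
  then have "degree ((1 + bitX) ^ k) \<le> 1 * k"
    by (intro order_trans[OF degree_power_le] mult_le_mono1)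
  then show ?thesis
    using assms by (intro coeff_eq_0) simp
qed

lemma sum_lessThan_add: "(\<Sum>k<m + n. f k) = (\<Sum>k<m. f k) + (\<Sum>k<n. f (m + k :: nat))"
  by (induction n) (simp_all add: add.assoc)

text \<open>Self-similarity: with q = 2^r, (1 + x)^(q + k) = (1 + x^q)(1 + x)^k. For k < q this is
  two disjoint copies of row k, so doubling the number of rows triples the total.\<close>

lemma sum_ell1_one_plus_x_powers:
  "(\<Sum>k<2 ^ r. ell1 ((1 + bitX) ^ k)) = 3 ^ r"
proof (induction r)
  case 0
  have "{k. coeff (1 :: bit poly) k = 1} = {0}" by auto
  then show ?case by (simp add: ell1_def)
next
  case (Suc r)
  let ?q = "2 ^ r :: nat" and ?w = "\<lambda>k. ell1 ((1 + bitX) ^ k)"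
  have double: "?w (?q + k) = 2 * ?w k" if "k < ?q" for k
  proof -
    have "(1 + bitX) ^ (?q + k)
        = (1 + bitX) ^ k + monom 1 ?q * (1 + bitX) ^ k"
      by (simp add: power_add bit_poly_freshman distrib_right flip: bitX_power)
    then show ?thesis
      using that by (simp add: ell1_add_monom_mult coeff_one_plus_x_power_eq_0)
  qed
  have "(\<Sum>k<2 ^ Suc r. ?w k) = (\<Sum>k<?q. ?w k) + (\<Sum>k<?q. ?w (?q + k))"
    by (simp only: power_Suc mult_2 sum_lessThan_add)
  also have "(\<Sum>k<?q. ?w (?q + k)) = 2 * (\<Sum>k<?q. ?w k)"
    by (simp add: double sum_distrib_left)
  finally show ?case by (simp add: Suc.IH)
qed

text \<open>Both sides times 1 + x give 1 + x^(2^r), and 1 + x cancels.\<close>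

lemma one_plus_x_power_pred:
  "(1 + bitX) ^ (2 ^ r - 1) = (\<Sum>i<2 ^ r. bitX ^ i)"
proof -
  have "coeff (1 + bitX) 0 = 1" by (simp add: bitX_def)
  then have nz: "1 + bitX \<noteq> 0" by (metis coeff_0 zero_neq_one)
  have "(1 + bitX) * (1 + bitX) ^ (2 ^ r - 1) = (1 + bitX) ^ (2 ^ r)"
    by (simp flip: power_Suc)
  also have "\<dots> = (1 + bitX) * (\<Sum>i<2 ^ r. bitX ^ i)"
    by (simp only: bit_poly_freshman bit_poly_geometric_sum)
  finally show ?thesis
    using nz by (simp only: mult_cancel_left) simp
qed

section \<open>The order\<close>

lemma poly_ord_props:
  assumes "coeff f 0 = 1"
  shows "poly_ord f \<ge> 1" "f dvd 1 + monom 1 (poly_ord f)"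
  using LeastI_ex[OF poly_ord_exists[OF assms]] unfolding poly_ord_def by auto

text \<open>Subtractive Euclidean descent: adding 1 + x^D to 1 + x^N leaves x^D (1 + x^(N - D)), and
  x^D cancels because \<open>f\<close> has constant term 1.\<close>

lemma poly_ord_dvd:
  assumes f0: "coeff f 0 = 1" and "f dvd 1 + monom 1 N"
  shows "poly_ord f dvd N"
  using assms(2)
proof (induction N rule: less_induct)
  case (less N)
  let ?D = "poly_ord f"
  note D = poly_ord_props[OF f0]
  show ?case
  proof (cases "N < ?D")
    case True
    \<comment> \<open>Minimality of the order excludes 1 \<le> N < D; the descent may end at
      \<open>N = 0\<close>, where 1 + x^N is zero.\<close>
    with less.prems have "N = 0"
      using not_less_Least[of N "\<lambda>D. D \<ge> 1 \<and> f dvd 1 + monom 1 D"]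
      unfolding poly_ord_def by fastforce
    then show ?thesis by simp
  next
    case False
    have "f dvd (1 + monom 1 ?D) + (1 + monom 1 N)"
      using D(2) less.prems by (rule dvd_add)
    also have "(1 + monom 1 ?D) + (1 + monom 1 N)
        = monom 1 ?D * (1 + monom (1 :: bit) (N - ?D))"
      using False by (simp add: distrib_left mult_monom ac_simps)
    finally have "f dvd 1 + monom 1 (N - ?D)"
      by (rule dvd_monom_mult_cancel[OF f0])
    with D(1) False have "?D dvd N - ?D"
      by (intro less.IH) auto
    with False show ?thesis by (simp add: dvd_diff_nat dvd_minus_self)
  qed
qed

lemma degree_one_plus_monom: "degree (1 + monom (1 :: bit) n) = n"
proof (cases "n = 0")
  case False
  then show ?thesis by (subst degree_add_eq_right) (simp_all add: degree_monom_eq)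
qed simp

lemma degree_quotient:
  assumes "f * g = 1 + monom (1 :: bit) N" "N \<ge> 1"
  shows "degree f + degree g = N"
proof -
  have "f * g \<noteq> 0"
    using assms degree_one_plus_monom[of N] by (metis degree_0 not_one_le_zero)
  then show ?thesis
    using degree_mult_eq[of f g] degree_one_plus_monom[of N] assms(1) by fastforce
qed

text \<open>Since 1 + x^(D m) is 1 + x^D times a geometric sum, \<open>h\<close> consists of
  \<open>m\<close> shifted copies of \<open>s\<close>. They do not overlap, because
  \<open>degree f \<ge> 1\<close> forces \<open>degree s < D\<close>.\<close>

lemma ell1_quotient_multiple:
  fixes f s :: "bit poly"
  assumes s: "f * s = 1 + monom 1 D" and h: "f * h = 1 + monom 1 (D * m)"
    and "degree f \<ge> 1" "D \<ge> 1"
  shows "ell1 h = m * ell1 s"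
proof -
  have "f * (\<Sum>j<m. monom 1 (D * j) * s) = (1 + monom 1 D) * (\<Sum>j<m. monom 1 D ^ j)"
    by (simp add: sum_distrib_left monom_power mult_ac flip: s)
  also have "\<dots> = f * h"
    by (simp only: bit_poly_geometric_sum h) (simp add: monom_power)
  finally have "h = (\<Sum>j<m. monom 1 (D * j) * s)"
    using assms(3) by auto
  moreover have "coeff s i = 0" if "i \<ge> D" for i
    using degree_quotient[OF s] assms that by (intro coeff_eq_0) auto
  ultimately show ?thesis
    using ell1_sum_blocks[of m D "\<lambda>_. s"] by simp
qed

section \<open>The quotient\<close>

lemma f_r2_factor:
  "f_r2 r = (1 + bitX) * (1 + bitX ^ (2 ^ r) * (1 + bitX))"
proof -
  have "f_r2 r = 1 + bitX + bitX ^ (2 ^ r) + bitX ^ (2 ^ r + 2)"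
    unfolding f_r2_def bitX_power by (simp add: bitX_def)
  then show ?thesis
    by (simp add: algebra_simps power2_eq_square power_add)
qed

lemma coeff_f_r2_0: "coeff (f_r2 r) 0 = 1"
  by (simp add: f_r2_def)

lemma degree_f_r2: "degree (f_r2 r) = 2 ^ r + 2"
proof -
  have "degree (1 + monom 1 1 + monom 1 (2 ^ r) :: bit poly) < 2 ^ r + 2"
    by (intro degree_add_less le_less_trans[OF degree_monom_le]) auto
  then show ?thesis
    unfolding f_r2_def by (subst degree_add_eq_right) (simp_all add: degree_monom_eq)
qed

text \<open>Block 0 is treated separately because \<open>k - 1\<close> would truncate to row 0
  there.\<close>

definition h_block :: "nat \<Rightarrow> nat \<Rightarrow> bit poly" where
  "h_block r k = (\<Sum>i<2 ^ r. bitX ^ i) + (if k = 0 then 0 else (1 + bitX) ^ (k - 1))"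

text \<open>The factor 1 + x telescopes the run of ones and advances row \<open>k - 1\<close> to row
  \<open>k\<close>.\<close>

lemma one_plus_x_mult_h_block:
  "(1 + bitX) * h_block r k = (1 + bitX ^ (2 ^ r)) + (if k = 0 then 0 else (1 + bitX) ^ k)"
proof (cases k)
  case 0
  then show ?thesis by (simp add: h_block_def bit_poly_geometric_sum)
next
  case (Suc n)
  then show ?thesis
    by (simp add: h_block_def distrib_left[of "1 + bitX"] bit_poly_geometric_sum)
qed

lemma f_r2_mult_blocks:
  "f_r2 r * (\<Sum>k<2 ^ r. monom 1 (2 ^ r * k) * h_block r k) = 1 + monom 1 (4 ^ r + 2 ^ r + 1)"
proof -
  define q :: nat where "q = 2 ^ r"
  define X u where "X = bitX ^ q" and "u = X * (1 + bitX)"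
  let ?H = "\<Sum>k<q. X ^ k * h_block r k"
  have "q > 0" by (simp add: q_def)
  have "(1 + bitX) * ?H = (\<Sum>k<q. (1 + X) * X ^ k + (if k = 0 then 0 else u ^ k))"
    unfolding sum_distrib_left
  proof (rule sum.cong)
    fix k
    have "(1 + bitX) * (X ^ k * h_block r k) = X ^ k * ((1 + bitX) * h_block r k)"
      by (simp only: mult_ac)
    also have "\<dots> = X ^ k * ((1 + X) + (if k = 0 then 0 else (1 + bitX) ^ k))"
      by (simp only: one_plus_x_mult_h_block X_def q_def)
    also have "\<dots> = (1 + X) * X ^ k + (if k = 0 then 0 else u ^ k)"
      by (simp add: u_def power_mult_distrib distrib_left[of "X ^ k"] mult.commute)
    finally show "(1 + bitX) * (X ^ k * h_block r k)
        = (1 + X) * X ^ k + (if k = 0 then 0 else u ^ k)" .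
  qed simp
  also have "\<dots> = (1 + X) * (\<Sum>k<q. X ^ k) + (\<Sum>k<q. if k = 0 then 0 else u ^ k)"
    by (simp only: sum.distrib sum_distrib_left)
  also have "(1 + X) * (\<Sum>k<q. X ^ k) = 1 + X ^ q"
    by (rule bit_poly_geometric_sum)
  \<comment> \<open>Restoring the missing term \<open>u ^ 0\<close> costs a 1, which cancels the 1
    in \<open>1 + X ^ q\<close>.\<close>
  also have "(\<Sum>k<q. if k = 0 then 0 else u ^ k) = 1 + (\<Sum>k<q. u ^ k)"
    using \<open>q > 0\<close> by (cases q) (simp_all add: sum.lessThan_Suc_shift del: sum.lessThan_Suc)
  also have "1 + X ^ q + (1 + (\<Sum>k<q. u ^ k)) = X ^ q + (\<Sum>k<q. u ^ k)"
    by (simp add: ac_simps)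
  finally have "(1 + u) * ((1 + bitX) * ?H) = (1 + u) * X ^ q + (1 + u) * (\<Sum>k<q. u ^ k)"
    by (simp only: distrib_left)
  also have "\<dots> = (1 + u) * X ^ q + (1 + u ^ q)"
    by (simp only: bit_poly_geometric_sum)
  \<comment> \<open>As \<open>q\<close> is a power of 2, (1 + x)^q = 1 + x^q = 1 +
    \<open>X\<close>.\<close>
  also have "u ^ q = X ^ q * (1 + X)"
    unfolding u_def power_mult_distrib by (simp add: q_def X_def bit_poly_freshman)
  also have "(1 + u) * X ^ q + (1 + X ^ q * (1 + X)) = 1 + X ^ q * X * bitX"
    by (simp add: u_def algebra_simps)
  also have "X ^ q * X * bitX = bitX ^ (q * q + q + 1)"
    by (simp add: X_def power_add power_mult)
  also have "q * q = 4 ^ r"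
    by (simp add: q_def flip: power_mult_distrib)
  finally show ?thesis
    unfolding f_r2_factor X_def u_def q_def by (simp only: mult_ac bitX_power monom_power power_one)
qed

lemma f_r2_dvd: "f_r2 r dvd 1 + monom 1 (4 ^ r + 2 ^ r + 1)"
  using f_r2_mult_blocks[of r] by (metis dvd_triv_left)

lemma h_r2_eq_blocks: "h_r2 r = (\<Sum>k<2 ^ r. monom 1 (2 ^ r * k) * h_block r k)"
proof -
  have "f_r2 r \<noteq> 0" using coeff_f_r2_0[of r] by auto
  then show ?thesis
    unfolding h_r2_def f_r2_mult_blocks[symmetric] by (rule nonzero_mult_div_cancel_left)
qed

lemma f_r2_mult_h_r2: "f_r2 r * h_r2 r = 1 + monom 1 (4 ^ r + 2 ^ r + 1)"
  unfolding h_r2_eq_blocks by (rule f_r2_mult_blocks)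

section \<open>Weight of the quotient\<close>

lemma ell1_h_r2_add: "ell1 (h_r2 r) + 3 ^ r = 4 ^ r + 2 ^ r"
proof -
  obtain n where n: "2 ^ r = Suc n" by (metis not0_implies_Suc power_not_zero zero_neq_numeral)
  let ?w = "\<lambda>k. ell1 ((1 + bitX) ^ k)"
  have "coeff (h_block r k) i = 0" if "k < 2 ^ r" "i \<ge> 2 ^ r" for k i
    using that by (simp add: h_block_def coeff_sum_powers coeff_one_plus_x_power_eq_0)
  then have "ell1 (h_r2 r) = (\<Sum>k<Suc n. ell1 (h_block r k))"
    unfolding h_r2_eq_blocks n[symmetric] by (rule ell1_sum_blocks)
  also have "\<dots> = ell1 (h_block r 0) + (\<Sum>k<n. ell1 (h_block r (Suc k)))"
    by (rule sum.lessThan_Suc_shift)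
  also have "ell1 (h_block r 0) = Suc n"
    by (simp add: h_block_def ell1_sum_powers flip: n)
  \<comment> \<open>Each block \<open>Suc k\<close> is paired with row \<open>k\<close>, its
    complement, so that every pair weighs \<open>Suc n\<close>.\<close>
  finally have "ell1 (h_r2 r) + (\<Sum>k<n. ?w k)
      = Suc n + (\<Sum>k<n. ell1 (h_block r (Suc k)) + ?w k)"
    by (simp add: sum.distrib)
  also have "(\<Sum>k<n. ell1 (h_block r (Suc k)) + ?w k) = (\<Sum>k<n. Suc n)"
    by (intro sum.cong refl)
      (simp add: h_block_def n ell1_complement coeff_one_plus_x_power_eq_0 del: sum.lessThan_Suc)
  finally have "ell1 (h_r2 r) + (\<Sum>k<n. ?w k) = Suc n * Suc n" by simp
  moreover have "(\<Sum>k<n. ?w k) + ?w n = 3 ^ r"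
    using sum_ell1_one_plus_x_powers[of r] by (simp add: n)
  \<comment> \<open>Row \<open>n\<close> is the last of the first 2^r rows and complements no block;
    its weight, all ones, accounts for the summand 2^r.\<close>
  moreover have "?w n = Suc n"
    using one_plus_x_power_pred[of r] ell1_sum_powers[of "Suc n"] by (simp add: n)
  moreover have "Suc n * Suc n = 4 ^ r"
    by (simp flip: n power_mult_distrib)
  ultimately show ?thesis using n by linarith
qed

lemma ell1_h_r2: "ell1 (h_r2 r) = c_r2 r"
  using ell1_h_r2_add[of r] power_mono[of 3 "4 :: nat" r] unfolding c_r2_def by simp

lemma beta_f_r2: "beta (4 ^ r + 2 ^ r + 1) (f_r2 r) = (c_r2 r, d_r2 r)"
proof -
  have "degree (h_r2 r) \<le> 4 ^ r + 2 ^ r"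
    using degree_quotient[OF f_r2_mult_h_r2[of r]] by (simp add: degree_f_r2)
  \<comment> \<open>There are 4^r + 2^r + 1 exponents in all; the extra one gives the
    \<open>+ 1\<close> in \<open>d_r2\<close>.\<close>
  from ell1_add_ell0[OF this] have "ell0 (4 ^ r + 2 ^ r) (h_r2 r) = d_r2 r"
    using ell1_h_r2_add[of r] unfolding d_r2_def by simp
  then show ?thesis
    unfolding beta_def h_r2_def[symmetric] Let_def by (simp add: ell1_h_r2)
qed

section \<open>Robustness\<close>

lemma two_mult_three_power_less: "r \<ge> 3 \<Longrightarrow> 2 * 3 ^ r < (4 :: nat) ^ r"
  by (induction r rule: nat_induct_at_least) simp_all

lemma robust_f_r2:
  assumes "r \<ge> 3"
  shows "robust (f_r2 r)"
proof -
  define f where "f = f_r2 r"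
  define D where "D = poly_ord f"
  define s where "s = poly_star f"
  have f0: "coeff f 0 = 1" and deg: "degree f = 2 ^ r + 2"
    by (simp_all add: f_def coeff_f_r2_0 degree_f_r2)
  have D: "D \<ge> 1" "f dvd 1 + monom 1 D"
    using poly_ord_props[OF f0] by (simp_all add: D_def)
  then have s: "f * s = 1 + monom 1 D"
    by (simp add: s_def poly_star_def D_def)
  have deg_s: "2 ^ r + 2 + degree s = D"
    using degree_quotient[OF s D(1)] by (simp add: deg)
  obtain m where m: "4 ^ r + 2 ^ r + 1 = D * m"
    using poly_ord_dvd[OF f0, of "4 ^ r + 2 ^ r + 1"] f_r2_dvd[of r]
    unfolding f_def D_def by (auto elim: dvdE)
  have "m * ell1 s = ell1 (h_r2 r)"
    using ell1_quotient_multiple[OF s, of "h_r2 r" m] f_r2_mult_h_r2[of r] D(1)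
    unfolding m by (simp add: deg flip: f_def)
  then have weight: "m * ell1 s + 3 ^ r = 4 ^ r + 2 ^ r"
    by (simp add: ell1_h_r2_add)
  have "m < 2 ^ r"
  \<comment> \<open>From D \<ge> deg f = 2^r + 2, \<open>m \<ge> 2 ^ r\<close> would give D m \<ge>
    4^r + 2 * 2^r, more than 4^r + 2^r + 1.\<close>
  proof (rule ccontr)
    assume "\<not> m < 2 ^ r"
    then have "(2 ^ r + 2) * 2 ^ r \<le> D * m"
      using deg_s by (intro mult_le_mono) auto
    moreover have "(2 ^ r + 2) * 2 ^ r = 4 ^ r + 2 * (2 ^ r :: nat)"
      by (simp add: distrib_right flip: power_mult_distrib)
    moreover have "(2 :: nat) ^ r > 1"
      using assms by (intro one_less_power) auto
    ultimately show False using m by linarith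
  qed
  \<comment> \<open>The left side is 4^r + 2^r + 1 + m \<le> 4^r + 2 * 2^r; the right side is 2 *
    4^r + 2 * 2^r - 2 * 3^r, which is larger because 2 * 3^r < 4^r.\<close>
  then have "m * (D + 1) < m * (2 * ell1 s)"
    using weight m two_mult_three_power_less[OF assms]
    by (simp add: algebra_simps)
  then have "D + 1 < 2 * ell1 s" by (simp only: mult_less_cancel1)
  moreover have "ell1 s + ell0 (D - 1) s = D"
    using ell1_add_ell0[of s "D - 1"] deg_s by simp
  ultimately have "ell1 s > ell0 (D - 1) s + 1" by linarith
  then show ?thesis
    using f0 deg unfolding robust_def f_def D_def s_def by simp
qed

theorem theorem2p10:
  fixes r :: nat
  assumes "r \<ge> 3"
  shows "(poly_ord (f_r2 r) dvd 4 ^ r + 2 ^ r + 1) \<and>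
    (f_r2 r dvd 1 + monom 1 (4 ^ r + 2 ^ r + 1) \<and> ell1 (h_r2 r) = c_r2 r) \<and>
    (beta (4 ^ r + 2 ^ r + 1) (f_r2 r) = (c_r2 r, d_r2 r) \<and> robust (f_r2 r))"
  using poly_ord_dvd[OF coeff_f_r2_0 f_r2_dvd] f_r2_dvd ell1_h_r2 beta_f_r2 robust_f_r2[OF assms]
  by blast

end
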